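(* Let $q$ be a prime power, and let $n\ge\ell\ge 0$ be integers. Let $\mathcal F\subseteq\mathbb F_q[x]$ be an $\ell$-intersecting family of monic polynomials of degree $n$ of maximum possible size (namely $q^{n-\ell}$) which is primary and non-trivial. Then either $q=2$, $\ell=1$, $n=3$ and $\mathcal F=\{x^2(x+1),\ x(x+1)^2,\ x(x^2+x+1),\ (x+1)(x^2+x+1)\}$, or there is a positive integer $d$ such that \[ \mathcal F=\mathcal F_d:=\left\{\frac{H_d}{p} : p\in\mathbb F_q[x] \text{ monic}, \deg(p)=d\right\}, \] where $H_d$ is the monic least common multiple of all polynomials of degree $d$ over $\mathbb F_q$.
   Context: $\mathbb F_q$ is the finite field with $q$ elements. A family $\mathcal F\subseteq\mathbb F_q[x]$ is $\ell$-intersecting if $\deg(\gcd(p_1,p_2))\geq\ell$ for all $p_1,p_2\in\mathcal F$. Such a maximum-size family of monic degree-$n$ polynomials is called trivial if there is a monic $g$ of degree $\ell$ with $\mathcal F=\{g\cdot p: p \text{ monic}, \deg(p)=n-\ell\}$, and non-trivial otherwise. It is called primary if no non-unit polynomial divides every element of $\mathcal F$. *)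

theory Defs
  imports
    "HOL-Library.Cardinality"
    "HOL-Computational_Algebra.Polynomial_Factorial"
begin

definition monic_polys :: "nat \<Rightarrow> 'a::field_gcd poly set" where
  "monic_polys n = {p. lead_coeff p = 1 \<and> degree p = n}"

definition intersecting :: "nat \<Rightarrow> 'a::field_gcd poly set \<Rightarrow> bool" where
  "intersecting l F \<longleftrightarrow> (\<forall>p\<in>F. \<forall>q\<in>F. degree (gcd p q) \<ge> l)"

definition max_intersecting :: "nat \<Rightarrow> nat \<Rightarrow> 'a::{finite,field_gcd} poly set \<Rightarrow> bool" where
  "max_intersecting n l F \<longleftrightarrow>
     F \<subseteq> monic_polys n \<and> intersecting l F \<and>
     (\<forall>G :: 'a poly set. G \<subseteq> monic_polys n \<and> intersecting l G \<longrightarrow> card G \<le> card F)"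

definition trivial_family :: "nat \<Rightarrow> nat \<Rightarrow> 'a::field_gcd poly set \<Rightarrow> bool" where
  "trivial_family n l F \<longleftrightarrow>
     (\<exists>g \<in> monic_polys l. F = {g * p |p. p \<in> monic_polys (n - l)})"

definition primary :: "'a::field_gcd poly set \<Rightarrow> bool" where
  "primary F \<longleftrightarrow> \<not> (\<exists>h. \<not> is_unit h \<and> (\<forall>p\<in>F. h dvd p))"

(* Over a field_gcd coefficient type, Lcm on polynomials returns the monic representative.
   Only d > 0 is meaningful here: for d = 0 the set contains the zero polynomial, as degree 0 = 0. *)
definition lcm_degree :: "nat \<Rightarrow> 'a::{finite,field_gcd} poly" where
  "lcm_degree d = Lcm {p. degree p = d}"

definition quotient_family :: "nat \<Rightarrow> 'a::{finite,field_gcd} poly set" where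
  "quotient_family d = {lcm_degree d div p |p. p \<in> monic_polys d}"

end

theory Submission
  imports Defs
begin

text \<open>
  Write \<open>q\<close> for the size of the field and \<open>m = n - l\<close>. Two distinct members of an \<open>l\<close>-intersecting family
  differ by a polynomial of degree at least \<open>l\<close>, so their top coefficients separate them and there
  are at most \<open>q ^ m\<close> of them.

  For a family \<open>F\<close> of exactly this size fix a monic irreducible \<open>P\<close> of degree \<open>m\<close>. The multiplicity of \<open>P\<close>
  is not constant on \<open>F\<close>. If it is smaller at \<open>f\<close> than at \<open>g\<close>, then \<open>P\<close> divides the cofactor of \<open>gcd f g\<close>
  in \<open>g\<close>, whose degree is at most \<open>m\<close>; hence \<open>g = P * h\<close> with \<open>h\<close> of degree \<open>l\<close> dividing \<open>f\<close>. So \<open>F\<close> is the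
  disjoint union of \<open>F0\<close> (minimal multiplicity) and \<open>P * K\<close>, where every \<open>h \<in> K\<close> divides every \<open>f \<in> F0\<close>.
  If \<open>K\<close> is a singleton, \<open>F\<close> is trivial; if \<open>F0 = {f}\<close>, then \<open>F\<close> consists of the quotients of \<open>P * f\<close>
  by all monic polynomials of degree \<open>m\<close>. Otherwise \<open>F0\<close> consists of multiples of a polynomial of
  degree greater than \<open>l\<close> and \<open>K\<close> of divisors of a polynomial of degree less than \<open>n\<close>, so both have at
  most \<open>q ^ (m - 1)\<close> elements, which forces \<open>q = 2\<close> and then \<open>m = 2\<close>.
\<close>

section \<open>Monic polynomials over a finite field\<close>

text \<open>Polynomial \<open>gcd\<close>, \<open>lcm\<close> and \<open>prime\<close> are
  normalized. The unit factor of a polynomial is that of its leading coefficient, which in a field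
  is the coefficient itself, so nonzero normalized polynomials are the monic ones.\<close>

lemma normalize_eq_self_iff_monic:
  fixes p :: "'a::field_gcd poly"
  assumes "p \<noteq> 0"
  shows "normalize p = p \<longleftrightarrow> lead_coeff p = 1"
proof
  have u: "is_unit (lead_coeff p)"
    using assms by (simp add: dvd_field_iff)
  assume "normalize p = p"
  then have "unit_factor p = 1"
    using assms by (metis unit_factor_normalize)
  then have "unit_factor (lead_coeff p) = 1"
    by (simp add: unit_factor_poly_def one_pCons)
  then show "lead_coeff p = 1"
    using u by (simp add: is_unit_unit_factor)
next
  assume "lead_coeff p = 1"
  then have "unit_factor p = 1"
    by (simp add: unit_factor_poly_def one_pCons)
  then show "normalize p = p"
    by (metis div_by_1 div_unit_factor)
qed

lemma monic_polysD:
  assumes "p \<in> monic_polys n"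
  shows "lead_coeff p = 1" "degree p = n" "p \<noteq> 0" "normalize p = p"
proof -
  show "lead_coeff p = 1" "degree p = n"
    using assms unfolding monic_polys_def by blast+
  then show "p \<noteq> 0"
    by auto
  then show "normalize p = p"
    using \<open>lead_coeff p = 1\<close> normalize_eq_self_iff_monic by blast
qed

lemma monic_polysI:
  fixes p :: "'a::field_gcd poly"
  assumes "normalize p = p" "p \<noteq> 0" "degree p = n"
  shows "p \<in> monic_polys n"
  using assms normalize_eq_self_iff_monic[of p] by (auto simp: monic_polys_def)

lemma monic_polys_0 [simp]: "monic_polys 0 = {1}"
  by (auto simp: monic_polys_def elim!: degree_eq_zeroE)

lemma monic_polys_mult:
  assumes "p \<in> monic_polys i" "r \<in> monic_polys j"
  shows "p * r \<in> monic_polys (i + j)"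
proof -
  have "degree (p * r) = degree p + degree r" "lead_coeff (p * r) = lead_coeff p * lead_coeff r"
    by (rule degree_mult_eq[OF monic_polysD(3)[OF assms(1)] monic_polysD(3)[OF assms(2)]],
        rule lead_coeff_mult)
  then show ?thesis
    using monic_polysD(1,2)[OF assms(1)] monic_polysD(1,2)[OF assms(2)] by (simp add: monic_polys_def)
qed

lemma monic_polys_power:
  assumes "p \<in> monic_polys i"
  shows "p ^ k \<in> monic_polys (k * i)"
  using assms by (induction k) (auto dest: monic_polys_mult)

lemma monic_polys_cofactor:
  assumes "p * r \<in> monic_polys n" "p \<in> monic_polys i"
  shows "r \<in> monic_polys (n - i)" "i \<le> n"
proof -
  have "r \<noteq> 0" "p \<noteq> 0"
    using assms(1) by (auto simp: monic_polys_def)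
  then have "degree (p * r) = degree p + degree r" "lead_coeff (p * r) = lead_coeff p * lead_coeff r"
    using degree_mult_eq[of p r] lead_coeff_mult[of p r] by blast+
  then show "r \<in> monic_polys (n - i)" "i \<le> n"
    using monic_polysD(1,2)[OF assms(1)] monic_polysD(1,2)[OF assms(2)] by (auto simp: monic_polys_def)
qed

lemma monic_dvd_imp_eq:
  assumes "p \<in> monic_polys n" "r \<in> monic_polys n" "p dvd r"
  shows "p = r"
proof -
  obtain s where s: "r = p * s"
    using assms(3) by (auto simp: dvd_def)
  then have "s \<in> monic_polys (n - n)"
    using monic_polys_cofactor[of p s n n] assms(1,2) by simp
  then show ?thesis
    using s by simp
qed

lemma gcd_monic_polys:
  assumes "f \<in> monic_polys n"
  shows "gcd f g \<in> monic_polys (degree (gcd f g))"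
  using monic_polysD(3)[OF assms] by (intro monic_polysI) auto

lemma degree_monic_diff_less:
  assumes "f \<in> monic_polys n" "g \<in> monic_polys n" "f \<noteq> g"
  shows "degree (f - g) < n"
proof -
  have "coeff (f - g) n = 0" "degree (f - g) \<le> n"
    using assms by (auto simp: monic_polys_def intro!: degree_diff_le)
  then show ?thesis
    using assms(3) by (metis eq_iff_diff_eq_0 leading_coeff_neq_0 le_neq_implies_less)
qed

text \<open>Coefficients rather than the degree define the set, so that the zero polynomial belongs
  to it for \<open>n = 0\<close> too; \<open>degree p < 0\<close> would exclude it.\<close>

definition low_polys :: "nat \<Rightarrow> 'a::zero poly set" where
  "low_polys n = {p. \<forall>i\<ge>n. coeff p i = 0}"

lemma low_polys_iff: "p \<in> low_polys n \<longleftrightarrow> p = 0 \<or> degree p < n"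
  unfolding low_polys_def by (auto simp: coeff_eq_0) (metis leI leading_coeff_0_iff)

lemma low_polys_0: "low_polys 0 = {0}"
  by (auto simp: low_polys_iff)

lemma low_polys_Suc: "low_polys (Suc n) = (\<lambda>(a, p). pCons a p) ` (UNIV \<times> low_polys n)"
proof -
  have "p \<in> (\<lambda>(a, p). pCons a p) ` (UNIV \<times> low_polys n)" if p: "p \<in> low_polys (Suc n)" for p :: "'a poly"
  proof -
    obtain a r where r: "p = pCons a r"
      by (cases p)
    then have "r \<in> low_polys n"
      using p by (force simp: low_polys_def coeff_pCons split: nat.splits)
    then show ?thesis
      using r by auto
  qed
  then show ?thesis
    by (fastforce simp: low_polys_def coeff_pCons split: nat.splits)
qed

lemma finite_low_polys [simp]: "finite (low_polys n :: 'a::{finite,zero} poly set)"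
  by (induction n) (auto simp: low_polys_0 low_polys_Suc)

lemma card_low_polys: "card (low_polys n :: 'a::{finite,zero} poly set) = CARD('a) ^ n"
proof (induction n)
  case (Suc n)
  have "inj_on (\<lambda>(a, p). pCons a p) (UNIV \<times> (low_polys n :: 'a poly set))"
    by (auto simp: inj_on_def)
  then show ?case
    using Suc by (simp add: low_polys_Suc card_image card_cartesian_product)
qed (simp add: low_polys_0)

lemma monic_polys_eq_image: "monic_polys n = (\<lambda>p. monom 1 n + p) ` low_polys n"
proof -
  have "p \<in> (\<lambda>p. monom 1 n + p) ` low_polys n" if "p \<in> monic_polys n" for p :: "'a poly"
  proof (rule image_eqI)
    show "p - monom 1 n \<in> low_polys n"
      using that by (auto simp: low_polys_def monic_polys_def coeff_eq_0)
  qed simp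
  moreover have "monom 1 n + p \<in> monic_polys n" if "p \<in> low_polys n" for p :: "'a poly"
  proof -
    have "coeff (monom 1 n + p) n = 1" "\<And>i. i > n \<Longrightarrow> coeff (monom 1 n + p) i = 0"
      using that by (auto simp: low_polys_def)
    moreover from this have "degree (monom 1 n + p) = n"
      by (metis degree_le le_degree le_antisym zero_neq_one)
    ultimately show ?thesis
      by (simp add: monic_polys_def)
  qed
  ultimately show ?thesis
    by blast
qed

lemma finite_monic_polys [simp]: "finite (monic_polys n :: 'a::{finite,field_gcd} poly set)"
  by (simp add: monic_polys_eq_image)

lemma card_monic_polys: "card (monic_polys n :: 'a::{finite,field_gcd} poly set) = CARD('a) ^ n"
  by (simp add: monic_polys_eq_image card_image card_low_polys inj_on_def)

lemma monic_polys_nonempty: "monic_polys n \<noteq> ({} :: 'a::field_gcd poly set)"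
  by (auto simp: monic_polys_eq_image low_polys_iff)

lemma monic_multiples:
  fixes A :: "'a::field_gcd poly"
  assumes "A \<in> monic_polys k"
  shows "{f \<in> monic_polys n. A dvd f} = (if k \<le> n then (*) A ` monic_polys (n - k) else {})"
proof -
  have "f \<in> (if k \<le> n then (*) A ` monic_polys (n - k) else {})"
    if "f \<in> monic_polys n" "A dvd f" for f
    using that assms monic_polys_cofactor[of A _ n k] by (auto elim!: dvdE)
  moreover have "A * r \<in> monic_polys n" if "k \<le> n" "r \<in> monic_polys (n - k)" for r
    using monic_polys_mult[OF assms that(2)] that(1) by simp
  ultimately show ?thesis
    by (auto split: if_splits)
qed

lemma card_monic_multiples:
  fixes A :: "'a::{finite,field_gcd} poly"
  assumes "A \<in> monic_polys k"
  shows "card {f \<in> monic_polys n. A dvd f} = (if k \<le> n then CARD('a) ^ (n - k) else 0)"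
  using assms monic_polysD(3)[OF assms]
  by (simp add: monic_multiples card_image inj_on_def card_monic_polys)

lemma card_UNIV_field_ge_2: "CARD('a::{finite,field_gcd}) \<ge> 2"
  using card_mono[of UNIV "{0, 1 :: 'a}"] by simp

section \<open>Irreducible polynomials of every degree\<close>

lemma prime_poly_monic:
  fixes P :: "'a::field_gcd poly"
  assumes "prime P"
  shows "P \<in> monic_polys (degree P)" "degree P > 0"
proof -
  show "P \<in> monic_polys (degree P)"
    using assms by (intro monic_polysI) (auto simp: normalize_prime)
  then show "degree P > 0"
    using assms by (metis gr0I monic_polys_0 not_prime_1 singletonD)
qed

text \<open>A pair \<open>(P, i)\<close> encodes the prime power \<open>P ^ i\<close>, of degree
  \<open>i * degree P\<close>. Primes are normalized, hence monic, so no prime is counted again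
  through an associate.\<close>

definition prime_powers_upto :: "nat \<Rightarrow> ('a::{finite,field_gcd} poly \<times> nat) set" where
  "prime_powers_upto n = {(P, i). prime P \<and> 0 < i \<and> i * degree P \<le> n}"

definition prime_powers_at :: "nat \<Rightarrow> ('a::{finite,field_gcd} poly \<times> nat) set" where
  "prime_powers_at n = {(P, i). prime P \<and> 0 < i \<and> i * degree P = n}"

lemma finite_monic_polys_upto: "finite {p :: 'a::{finite,field_gcd} poly. p \<in> monic_polys (degree p) \<and> degree p \<le> n}"
  by (rule finite_subset[of _ "\<Union>k\<le>n. monic_polys k"]) auto

lemma finite_primes_upto: "finite {P :: 'a::{finite,field_gcd} poly. prime P \<and> degree P \<le> n}"
  by (rule finite_subset[OF _ finite_monic_polys_upto[of n]]) (auto simp: prime_poly_monic)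

lemma finite_prime_powers_upto: "finite (prime_powers_upto n :: ('a::{finite,field_gcd} poly \<times> nat) set)"
proof (rule finite_subset)
  show "finite ({P :: 'a poly. prime P \<and> degree P \<le> n} \<times> {..n})"
    by (simp add: finite_primes_upto)
  show "(prime_powers_upto n :: ('a poly \<times> nat) set) \<subseteq> {P. prime P \<and> degree P \<le> n} \<times> {..n}"
  proof safe
    fix P :: "'a poly" and i
    assume "(P, i) \<in> prime_powers_upto n"
    then have *: "prime P" "0 < i" "i * degree P \<le> n"
      by (auto simp: prime_powers_upto_def)
    have "1 * degree P \<le> i * degree P" "i * 1 \<le> i * degree P"
      using * prime_poly_monic(2)[of P] by (intro mult_le_mono; simp)+
    then show "prime P" "degree P \<le> n" "i \<le> n"
      using * by linarith+
  qed
qed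

text \<open>A prime factor \<open>P\<close> of \<open>f\<close> gives the pairs
  \<open>(P, i)\<close> with \<open>1 \<le> i \<le> multiplicity P f\<close>, so its degree is
  counted as often as \<open>P\<close> occurs in the factorization of \<open>f\<close>.\<close>

lemma sum_degree_prime_powers_dvd:
  fixes f :: "'a::{finite,field_gcd} poly"
  assumes "f \<in> monic_polys n"
  shows "(\<Sum>x | x \<in> prime_powers_upto n \<and> fst x ^ snd x dvd f. degree (fst x)) = n"
proof -
  have f0: "f \<noteq> 0" "degree f = n" "normalize f = f"
    using monic_polysD[OF assms] by auto
  have "{x \<in> prime_powers_upto n. fst x ^ snd x dvd f}
      = Sigma (prime_factors f) (\<lambda>P. {1..multiplicity P f})"
  proof (intro set_eqI iffI; clarsimp)
    fix P i
    assume *: "(P, i) \<in> prime_powers_upto n" "P ^ i dvd f"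
    then have "prime P" "0 < i"
      by (auto simp: prime_powers_upto_def)
    moreover from this have "i \<le> multiplicity P f"
      using * f0 by (intro multiplicity_geI) auto
    ultimately show "P \<in> prime_factors f \<and> Suc 0 \<le> i \<and> i \<le> multiplicity P f"
      by (auto simp: prime_factors_multiplicity)
  next
    fix P i
    assume *: "P \<in> prime_factors f" "Suc 0 \<le> i" "i \<le> multiplicity P f"
    then have P: "prime P" "P ^ i dvd f"
      by (auto simp: multiplicity_dvd')
    then have "degree (P ^ i) \<le> n"
      using f0 dvd_imp_degree_le by blast
    then show "(P, i) \<in> prime_powers_upto n \<and> P ^ i dvd f"
      using P *(2) by (auto simp: prime_powers_upto_def degree_power_eq)
  qed
  then have "(\<Sum>x | x \<in> prime_powers_upto n \<and> fst x ^ snd x dvd f. degree (fst x))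
      = (\<Sum>(P, i)\<in>Sigma (prime_factors f) (\<lambda>P. {1..multiplicity P f}). degree P)"
    by (simp add: case_prod_beta)
  also have "\<dots> = (\<Sum>P\<in>prime_factors f. multiplicity P f * degree P)"
    by (simp add: sum.Sigma[symmetric])
  also have "\<dots> = (\<Sum>P\<in>prime_factors f. degree (P ^ multiplicity P f))"
    by (intro sum.cong) (auto simp: degree_power_eq in_prime_factors_iff)
  also have "\<dots> = degree (\<Prod>P\<in>prime_factors f. P ^ multiplicity P f)"
    by (subst degree_prod_eq_sum_degree) auto
  also have "\<dots> = n"
    using f0 by (simp add: prod_prime_factors)
  finally show ?thesis .
qed

text \<open>Double counting of monic \<open>f\<close> of degree \<open>n\<close> together with a
  prime power dividing \<open>f\<close>, weighted by \<open>degree P\<close>: each \<open>f\<close>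
  contributes \<open>n\<close>, and \<open>P ^ i\<close> divides exactly
  \<open>CARD('a) ^ (n - i * degree P)\<close> of them.\<close>

lemma sum_prime_powers_upto:
  "(\<Sum>(P :: 'a::{finite,field_gcd} poly, i) \<in> prime_powers_upto n. degree P * CARD('a) ^ (n - i * degree P))
    = n * CARD('a) ^ n" (is "?L = _")
proof -
  have "n * CARD('a) ^ n = (\<Sum>f\<in>(monic_polys n :: 'a poly set). n)"
    by (simp add: card_monic_polys)
  also have "\<dots> = (\<Sum>f\<in>(monic_polys n :: 'a poly set).
      \<Sum>x\<in>{x \<in> prime_powers_upto n. fst x ^ snd x dvd f}. degree (fst x))"
    by (intro sum.cong refl sum_degree_prime_powers_dvd[symmetric])
  also have "\<dots> = (\<Sum>x\<in>prime_powers_upto n.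
      \<Sum>f\<in>{f \<in> (monic_polys n :: 'a poly set). fst x ^ snd x dvd f}. degree (fst x))"
    by (rule sum.swap_restrict) (simp_all add: finite_prime_powers_upto)
  also have "\<dots> = ?L"
  proof (intro sum.cong refl)
    fix x :: "'a poly \<times> nat"
    assume "x \<in> prime_powers_upto n"
    then have x: "prime (fst x)" "snd x * degree (fst x) \<le> n"
      by (auto simp: prime_powers_upto_def)
    then have "fst x ^ snd x \<in> monic_polys (snd x * degree (fst x))"
      by (intro monic_polys_power prime_poly_monic)
    then show "(\<Sum>f\<in>{f \<in> monic_polys n. fst x ^ snd x dvd f}. degree (fst x))
        = (case x of (P, i) \<Rightarrow> degree P * CARD('a) ^ (n - i * degree P))"
      using x(2) by (simp add: card_monic_multiples case_prod_beta)
  qed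
  finally show ?thesis ..
qed

text \<open>Comparing the degree counts for \<open>n\<close> and \<open>n - 1\<close> isolates the prime powers of degree exactly \<open>n\<close>.
  This is Gauss's formula \<open>q ^ n = (\<Sum>d | d dvd n. d * N d)\<close>, where \<open>N d\<close> counts the monic irreducibles
  of degree \<open>d\<close>.\<close>

lemma sum_prime_powers_at:
  assumes "n > 0"
  shows "(\<Sum>(P :: 'a::{finite,field_gcd} poly, i) \<in> prime_powers_at n. degree P) = CARD('a) ^ n"
proof -
  let ?q = "CARD('a)"
  obtain k where n: "n = Suc k"
    using assms by (cases n) auto
  let ?U = "\<lambda>n. prime_powers_upto n :: ('a poly \<times> nat) set"
  let ?A = "prime_powers_at n :: ('a poly \<times> nat) set"
  have split: "?U n = ?U k \<union> ?A" "?U k \<inter> ?A = {}"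
    unfolding n by (auto simp: prime_powers_upto_def prime_powers_at_def)
  have fin: "finite (?U k)" "finite ?A"
    using finite_prime_powers_upto[of n, where 'a='a] unfolding split(1) by auto
  have "n * ?q ^ n = (\<Sum>(P, i)\<in>?U n. degree P * ?q ^ (n - i * degree P))"
    by (rule sum_prime_powers_upto[symmetric])
  also have "\<dots> = (\<Sum>(P, i)\<in>?U k. degree P * ?q ^ (n - i * degree P))
      + (\<Sum>(P, i)\<in>?A. degree P * ?q ^ (n - i * degree P))"
    unfolding split(1) by (rule sum.union_disjoint[OF fin split(2)])
  also have "(\<Sum>(P, i)\<in>?A. degree P * ?q ^ (n - i * degree P)) = (\<Sum>(P, i)\<in>?A. degree P)"
    by (intro sum.cong) (auto simp: prime_powers_at_def)
  also have "(\<Sum>(P, i)\<in>?U k. degree P * ?q ^ (n - i * degree P))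
      = ?q * (\<Sum>(P, i)\<in>?U k. degree P * ?q ^ (k - i * degree P))"
    unfolding sum_distrib_left n
    by (intro sum.cong) (auto simp: prime_powers_upto_def Suc_diff_le)
  also have "\<dots> = ?q * (k * ?q ^ k)"
    by (simp only: sum_prime_powers_upto)
  finally have "n * ?q ^ n = k * ?q ^ n + (\<Sum>(P, i)\<in>?A. degree P)"
    by (simp add: n ac_simps)
  then show ?thesis
    by (simp add: n)
qed

lemma sum_degree_primes_at_le:
  assumes "n > 0"
  shows "(\<Sum>P | prime P \<and> degree P = n. degree (P :: 'a::{finite,field_gcd} poly)) \<le> CARD('a) ^ n"
proof -
  have "(\<Sum>P | prime P \<and> degree P = n. degree (P :: 'a poly))
      = (\<Sum>(P, i) \<in> (\<lambda>P. (P, 1 :: nat)) ` {P :: 'a poly. prime P \<and> degree P = n}. degree P)"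
    by (subst sum.reindex) (auto simp: inj_on_def)
  also have "\<dots> \<le> (\<Sum>(P :: 'a poly, i) \<in> prime_powers_at n. degree P)"
  proof (rule sum_mono2)
    show "finite (prime_powers_at n :: ('a poly \<times> nat) set)"
      by (rule finite_subset[OF _ finite_prime_powers_upto[of n]])
         (auto simp: prime_powers_at_def prime_powers_upto_def)
  qed (auto simp: prime_powers_at_def)
  also have "\<dots> = CARD('a) ^ n"
    by (rule sum_prime_powers_at[OF assms])
  finally show ?thesis .
qed

text \<open>With \<open>q = CARD('a)\<close>, degree \<open>k\<close> contributes at most
  \<open>q ^ k\<close>; since \<open>q \<ge> 2\<close>, the sum of these powers stays below the next
  power.\<close>

lemma sum_degree_primes_upto_less:
  "(\<Sum>P | prime P \<and> degree P \<le> n. degree (P :: 'a::{finite,field_gcd} poly)) < CARD('a) ^ Suc n"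
proof (induction n)
  case 0
  have "{P :: 'a poly. prime P \<and> degree P \<le> 0} = {}"
    using prime_poly_monic(2) by force
  then show ?case
    by simp
next
  case (Suc n)
  let ?q = "CARD('a)"
  have "{P :: 'a poly. prime P \<and> degree P \<le> Suc n}
      = {P. prime P \<and> degree P \<le> n} \<union> {P. prime P \<and> degree P = Suc n}"
    by auto
  then have "(\<Sum>P | prime P \<and> degree P \<le> Suc n. degree (P :: 'a poly))
      \<le> (\<Sum>P | prime P \<and> degree P \<le> n. degree (P :: 'a poly))
        + (\<Sum>P | prime P \<and> degree P = Suc n. degree (P :: 'a poly))"
    using finite_primes_upto[of "Suc n", where 'a='a]
    by (simp only:) (subst sum.union_disjoint; auto)
  also have "\<dots> < ?q ^ Suc n + ?q ^ Suc n"
    using Suc sum_degree_primes_at_le[of "Suc n", where 'a='a] by linarith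
  also have "\<dots> = 2 * ?q ^ Suc n"
    by simp
  also have "\<dots> \<le> ?q * ?q ^ Suc n"
    by (intro mult_right_mono card_UNIV_field_ge_2) auto
  finally show ?case
    by simp
qed

text \<open>Otherwise every prime power of degree \<open>n\<close> has a base whose degree is a
  proper divisor of \<open>n\<close>, and the base determines the exponent. The sum in Gauss's
  formula is then bounded by the degrees of all primes of degree below \<open>n\<close>, which is
  too little.\<close>

lemma exists_prime_poly_degree:
  assumes "n > 0"
  shows "\<exists>P :: 'a::{finite,field_gcd} poly. prime P \<and> degree P = n"
proof (rule ccontr)
  assume none: "\<nexists>P :: 'a poly. prime P \<and> degree P = n"
  obtain k where n: "n = Suc k"
    using assms by (cases n) auto
  let ?A = "prime_powers_at n :: ('a poly \<times> nat) set"
  have inj: "inj_on fst ?A"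
    using assms by (auto simp: inj_on_def prime_powers_at_def)
  have sub: "fst ` ?A \<subseteq> {P. prime P \<and> degree P \<le> k}"
  proof safe
    fix P :: "'a poly" and i
    assume "(P, i) \<in> ?A"
    then have *: "prime P" "0 < i" "i * degree P = n"
      by (auto simp: prime_powers_at_def)
    then have "degree P dvd n" "degree P \<noteq> n"
      using none by (metis dvd_triv_right, blast)
    then have "degree P < n"
      using assms by (meson dvd_imp_le le_neq_implies_less)
    then show "prime (fst (P, i))" "degree (fst (P, i)) \<le> k"
      using * n by auto
  qed
  have "CARD('a) ^ n = (\<Sum>x\<in>?A. degree (fst x))"
    using sum_prime_powers_at[OF assms, where 'a='a] by (simp add: case_prod_beta)
  also have "\<dots> = (\<Sum>P\<in>fst ` ?A. degree P)"
    by (simp add: sum.reindex[OF inj])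
  also have "\<dots> \<le> (\<Sum>P | prime P \<and> degree P \<le> k. degree (P :: 'a poly))"
    by (rule sum_mono2[OF finite_primes_upto sub]) auto
  also have "\<dots> < CARD('a) ^ n"
    unfolding n by (rule sum_degree_primes_upto_less)
  finally show False
    by simp
qed

section \<open>Intersecting families of maximum size\<close>

lemma intersecting_degree_diff:
  assumes "intersecting l F" "f \<in> F" "g \<in> F" "f \<noteq> g"
  shows "l \<le> degree (f - g)"
proof -
  have "gcd f g dvd f - g"
    by simp
  then have "degree (gcd f g) \<le> degree (f - g)"
    using assms(4) by (intro dvd_imp_degree_le) auto
  then show ?thesis
    using assms by (force simp: intersecting_def)
qed

lemma monic_polys_add_low:
  assumes "f \<in> monic_polys n" "r \<in> low_polys n"
  shows "f + r \<in> monic_polys n"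
  using assms by (auto simp: monic_polys_eq_image low_polys_def add.assoc)

text \<open>A packing argument: the translates of \<open>F\<close> by the
  \<open>CARD('a) ^ l\<close> elements of \<open>low_polys l\<close> are pairwise disjoint, and all
  lie among the \<open>CARD('a) ^ n\<close> monic polynomials of degree \<open>n\<close>.\<close>

lemma card_intersecting_le:
  fixes F :: "'a::{finite,field_gcd} poly set"
  assumes "F \<subseteq> monic_polys n" "intersecting l F" "l \<le> n"
  shows "card F \<le> CARD('a) ^ (n - l)"
proof -
  have "inj_on (\<lambda>(f, r). f + r) (F \<times> low_polys l)"
  proof (rule inj_onI; clarify)
    fix f g r s
    assume *: "f \<in> F" "g \<in> F" "r \<in> low_polys l" "s \<in> low_polys l" "f + r = g + s"
    then have "f - g = s - r"
      by (simp add: algebra_simps)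
    moreover have "s - r \<in> low_polys l"
      using * by (auto simp: low_polys_def)
    ultimately have "f = g"
      using intersecting_degree_diff[OF assms(2) *(1,2)] by (fastforce simp: low_polys_iff)
    then show "f = g \<and> r = s"
      using * by simp
  qed
  moreover have "(\<lambda>(f, r). f + r) ` (F \<times> low_polys l) \<subseteq> monic_polys n"
    using assms(1,3) by (auto intro!: monic_polys_add_low simp: low_polys_def)
  ultimately have "card (F \<times> (low_polys l :: 'a poly set)) \<le> card (monic_polys n :: 'a poly set)"
    by (intro card_inj_on_le) auto
  then have "card F * CARD('a) ^ l \<le> CARD('a) ^ (n - l) * CARD('a) ^ l"
    using assms(3) by (simp add: card_cartesian_product card_low_polys card_monic_polys flip: power_add)
  then show ?thesis
    by simp
qed

lemma intersecting_multiples: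
  assumes "g \<in> monic_polys l"
  shows "intersecting l {f \<in> monic_polys n. g dvd f}"
  unfolding intersecting_def
proof safe
  fix p r
  assume *: "p \<in> monic_polys n" "g dvd p" "g dvd r"
  then have "degree g \<le> degree (gcd p r)"
    using monic_polysD(3) by (intro dvd_imp_degree_le) auto
  then show "l \<le> degree (gcd p r)"
    using monic_polysD(2)[OF assms] by simp
qed

text \<open>The multiples of one fixed monic polynomial of degree \<open>l\<close> attain the upper
  bound.\<close>

lemma card_max_intersecting:
  fixes F :: "'a::{finite,field_gcd} poly set"
  assumes "max_intersecting n l F" "l \<le> n"
  shows "card F = CARD('a) ^ (n - l)"
proof (rule antisym)
  show "card F \<le> CARD('a) ^ (n - l)"
    using assms card_intersecting_le[of F n l] by (simp add: max_intersecting_def)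
  obtain g :: "'a poly" where g: "g \<in> monic_polys l"
    using monic_polys_nonempty by blast
  have "card {f \<in> monic_polys n. g dvd f} \<le> card F"
    using assms(1) intersecting_multiples[OF g, of n] by (auto simp: max_intersecting_def)
  then show "CARD('a) ^ (n - l) \<le> card F"
    using g assms(2) by (simp add: card_monic_multiples)
qed

text \<open>\<open>h\<close> has exactly \<open>CARD('a) ^ (n - l)\<close> monic multiples of degree
  \<open>n\<close>, so inclusion in them is already equality.\<close>

lemma trivial_familyI:
  fixes F :: "'a::{finite,field_gcd} poly set"
  assumes "F \<subseteq> monic_polys n" "l \<le> n" "card F = CARD('a) ^ (n - l)"
    and h: "h \<in> monic_polys l" "\<And>f. f \<in> F \<Longrightarrow> h dvd f"
  shows "trivial_family n l F"
proof -
  have "F = {f \<in> monic_polys n. h dvd f}"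
    using assms by (intro card_subset_eq) (auto simp: card_monic_multiples)
  also have "\<dots> = (*) h ` monic_polys (n - l)"
    using monic_multiples[OF h(1), of n] assms(2) by simp
  finally show ?thesis
    using h(1) by (auto simp: trivial_family_def)
qed

text \<open>If the multiplicity were constant, cancelling the common power of \<open>P\<close> would embed \<open>F\<close>
  into the nonzero residues modulo \<open>P\<close>, of which there is one too few.\<close>

lemma multiplicity_not_constant:
  fixes F :: "'a::{finite,field_gcd} poly set"
  assumes F: "F \<subseteq> monic_polys n" "intersecting l F" "l \<le> n" "card F = CARD('a) ^ (n - l)"
    and P: "prime P" "degree P = n - l"
    and const: "\<And>f. f \<in> F \<Longrightarrow> multiplicity P f = v"
  shows False
proof -
  have P0: "P \<noteq> 0" "\<not> is_unit P" "degree P > 0"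
    using P(1) prime_poly_monic(2) by auto
  define c where "c f = f div P ^ v" for f
  have c: "f = P ^ v * c f" "\<not> P dvd c f" if "f \<in> F" for f
  proof -
    have "P ^ v dvd f"
      using const[OF that] multiplicity_dvd by metis
    then show eq: "f = P ^ v * c f"
      by (simp add: c_def)
    have "f \<noteq> 0"
      using that F(1) monic_polysD(3) by blast
    then have "\<not> P ^ Suc v dvd f"
      using const[OF that] P0 multiplicity_geI[of f P "Suc v"] by fastforce
    then show "\<not> P dvd c f"
      using eq by (metis dvd_refl mult_dvd_mono power_Suc2)
  qed
  have "inj_on (\<lambda>f. c f mod P) F"
  proof (rule inj_onI, rule ccontr)
    fix f g
    assume fg: "f \<in> F" "g \<in> F" "c f mod P = c g mod P" "f \<noteq> g"
    define h where "h = gcd (c f) (c g)"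
    have ne: "f \<noteq> 0" "g \<noteq> 0" "f - g \<noteq> 0"
      using fg F(1) monic_polysD(3) by auto
    have "\<not> P dvd h"
      using c(2)[OF fg(1)] by (simp add: h_def)
    then have "coprime h P"
      using P(1) by (metis coprime_commute prime_imp_coprime)
    moreover have "P dvd c f - c g" "h dvd c f - c g"
      using fg(3) by (simp_all add: h_def mod_eq_dvd_iff)
    \<comment> \<open>Restoring \<open>P ^ v\<close> gives \<open>f - g\<close> a divisor of degree
      at least \<open>l + (n - l) = n\<close>, impossible for a nonzero difference of monic
      polynomials of degree \<open>n\<close>.\<close>
    ultimately have "h * P dvd c f - c g"
      by (intro divides_mult) auto
    then have "P ^ v * (h * P) dvd P ^ v * (c f - c g)"
      by (intro mult_dvd_mono) auto
    then have dvd: "(P ^ v * h) * P dvd f - g"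
      using c(1)[OF fg(1)] c(1)[OF fg(2)] by (metis mult.assoc right_diff_distrib)
    have "gcd f g = normalize (P ^ v * h)"
      using c(1)[OF fg(1)] c(1)[OF fg(2)] by (metis gcd_mult_left h_def)
    then have "gcd f g dvd P ^ v * h"
      by simp
    moreover have h0: "P ^ v * h \<noteq> 0"
      using dvd ne by auto
    ultimately have "degree (gcd f g) \<le> degree (P ^ v * h)"
      by (rule dvd_imp_degree_le)
    then have "l \<le> degree (P ^ v * h)"
      using F(2) fg by (force simp: intersecting_def)
    moreover note h0
    ultimately have "n \<le> degree (P ^ v * h * P)"
      using P0(1) P(2) by (subst degree_mult_eq) auto
    also have "\<dots> \<le> degree (f - g)"
      using dvd ne by (intro dvd_imp_degree_le)
    also have "\<dots> < n"
      using fg F(1) by (intro degree_monic_diff_less) auto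
    finally show False
      by simp
  qed
  moreover have "(\<lambda>f. c f mod P) ` F \<subseteq> low_polys (n - l) - {0}"
    using c(2) P(2) P0 degree_mod_less'[of P]
    by (auto simp: low_polys_iff mod_eq_0_iff_dvd)
  ultimately have "card F \<le> card (low_polys (n - l) - {0} :: 'a poly set)"
    by (intro card_inj_on_le) auto
  also have "\<dots> < card (low_polys (n - l) :: 'a poly set)"
    by (rule card_Diff1_less) (simp_all add: low_polys_iff)
  finally show False
    using F(4) by (simp add: card_low_polys)
qed

section \<open>Separating the members by their multiplicity at a prime\<close>

lemma eq_prime_times_gcd_of_multiplicity_less:
  fixes f g P :: "'a::field_gcd poly"
  assumes fg: "f \<in> monic_polys n" "g \<in> monic_polys n" "degree (gcd f g) \<ge> l"
    and P: "prime P" "degree P = n - l"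
    and less: "multiplicity P f < multiplicity P g"
  shows "gcd f g \<in> monic_polys l" "g = P * gcd f g"
proof -
  define d where "d = gcd f g"
  have d: "d \<in> monic_polys (degree d)"
    unfolding d_def by (rule gcd_monic_polys[OF fg(1)])
  obtain b where b: "g = d * b"
    unfolding d_def by (metis dvdE gcd_dvd2)
  have b': "b \<in> monic_polys (n - degree d)" "degree d \<le> n"
    using monic_polys_cofactor[of d b n] fg(2) d b by auto
  have "multiplicity P d \<le> multiplicity P f"
    using monic_polysD(3)[OF fg(1)] by (intro dvd_imp_multiplicity_le) (auto simp: d_def)
  moreover have "multiplicity P g = multiplicity P d + multiplicity P b"
    unfolding b using P(1) monic_polysD(3)[OF d] monic_polysD(3)[OF b'(1)]
    by (intro prime_elem_multiplicity_mult_distrib) auto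
  \<comment> \<open>\<open>P\<close> occurs in \<open>d\<close> no more often than in
    \<open>f\<close>, so the surplus at \<open>g\<close> must sit in the cofactor
    \<open>b\<close>.\<close>
  ultimately have "multiplicity P b \<noteq> 0"
    using less by linarith
  then have Pb: "P dvd b"
    using not_dvd_imp_multiplicity_0[of P b] by argo
  then have "degree P \<le> degree b"
    using monic_polysD(3)[OF b'(1)] by (intro dvd_imp_degree_le)
  \<comment> \<open>\<open>degree b = n - degree d \<le> n - l = degree P\<close>, so
    \<open>P dvd b\<close> forces equality.\<close>
  then have deg: "degree d = l"
    using P(2) b'(2) monic_polysD(2)[OF b'(1)] fg(3) unfolding d_def by linarith
  then have "P = b"
    using monic_dvd_imp_eq[OF _ _ Pb, of "n - l"] b'(1) prime_poly_monic(1)[OF P(1)] P(2) by simp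
  then show "g = P * gcd f g" "gcd f g \<in> monic_polys l"
    using b d deg by (simp_all add: d_def mult.commute)
qed

lemma split_by_multiplicity:
  fixes F :: "'a::{finite,field_gcd} poly set"
  assumes F: "F \<subseteq> monic_polys n" "intersecting l F" "l \<le> n" "card F = CARD('a) ^ (n - l)"
    and P: "prime P" "degree P = n - l"
  obtains F0 K where "F = F0 \<union> (*) P ` K" "F0 \<inter> (*) P ` K = {}" "F0 \<noteq> {}" "K \<noteq> {}"
    "K \<subseteq> monic_polys l" "\<And>f h. f \<in> F0 \<Longrightarrow> h \<in> K \<Longrightarrow> h dvd f"
proof -
  obtain f1 where "f1 \<in> F"
    using F(4) by fastforce
  then obtain f0 where f0: "f0 \<in> F" "\<And>f. f \<in> F \<Longrightarrow> multiplicity P f0 \<le> multiplicity P f"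
    using ex_has_least_nat[of "\<lambda>f. f \<in> F" f1 "multiplicity P"] by blast
  define F0 where "F0 = {f \<in> F. multiplicity P f = multiplicity P f0}"
  define K where "K = {h. P * h \<in> F - F0}"
  have key: "gcd f g \<in> monic_polys l" "g = P * gcd f g" if "f \<in> F0" "g \<in> F - F0" for f g
  proof -
    have "multiplicity P f < multiplicity P g"
      using that f0(2)[of g] by (auto simp: F0_def)
    then show "gcd f g \<in> monic_polys l" "g = P * gcd f g"
      using that F P eq_prime_times_gcd_of_multiplicity_less[of f n g l P]
      by (auto simp: F0_def intersecting_def)
  qed
  have P0: "P \<noteq> 0"
    using P(1) by auto
  have "f0 \<in> F0"
    using f0 by (simp add: F0_def)
  have img: "(*) P ` K = F - F0"
  proof
    show "F - F0 \<subseteq> (*) P ` K"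
    proof
      fix g
      assume g: "g \<in> F - F0"
      then have "P * gcd f0 g \<in> F - F0"
        using key(2)[OF \<open>f0 \<in> F0\<close> g] by simp
      then show "g \<in> (*) P ` K"
        using key(2)[OF \<open>f0 \<in> F0\<close> g] by (intro image_eqI[of _ _ "gcd f0 g"]) (simp_all add: K_def)
    qed
  qed (auto simp: K_def)
  have K: "h \<in> monic_polys l" "h dvd f" if "f \<in> F0" "h \<in> K" for f h
  proof -
    have "P * h \<in> F - F0"
      using that by (simp add: K_def)
    note * = key[OF that(1) this]
    \<comment> \<open>Cancelling \<open>P\<close> identifies \<open>h\<close> with a gcd involving
      \<open>f\<close>. As \<open>f\<close> is any member of \<open>F0\<close>, \<open>h\<close>
      divides all of them.\<close>
    have eq: "h = gcd f (P * h)"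
      using *(2) P0 mult_left_cancel[of P] by blast
    show "h \<in> monic_polys l"
      by (subst eq) (rule *(1))
    show "h dvd f"
      by (subst eq) (rule gcd_dvd1)
  qed
  have "F - F0 \<noteq> {}"
    using multiplicity_not_constant[OF F P, of "multiplicity P f0"] by (auto simp: F0_def)
  then show thesis
    using that[of F0 K] img K \<open>f0 \<in> F0\<close> by (auto simp: F0_def)
qed

section \<open>Recognising the quotient families\<close>

lemma eq_lcm_degree:
  fixes H :: "'a::{finite,field_gcd} poly"
  assumes H: "H \<in> monic_polys N" "\<And>p. p \<in> monic_polys d \<Longrightarrow> p dvd H"
    and d: "d > 0" and prim: "primary {H div p |p. p \<in> monic_polys d}"
  shows "H = lcm_degree d"
proof -
  define L :: "'a poly" where "L = lcm_degree d"
  have "p dvd H" if "degree p = d" for p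
  proof -
    \<comment> \<open>\<open>d > 0\<close> keeps the zero polynomial out of the set whose
      \<open>Lcm\<close> is taken.\<close>
    have "p \<noteq> 0"
      using that d by auto
    moreover from this have "degree (normalize p) = d"
      using that by (intro antisym) (auto intro!: dvd_imp_degree_le)
    ultimately have "normalize p \<in> monic_polys d"
      by (intro monic_polysI) auto
    then show ?thesis
      using H(2) by fastforce
  qed
  then have "L dvd H"
    unfolding L_def lcm_degree_def by (intro Lcm_least) auto
  then obtain c where c: "H = L * c"
    by (elim dvdE)
  \<comment> \<open>Dividing by \<open>p\<close> only affects the factor \<open>L\<close>, so
    \<open>c\<close> survives in every quotient and primarity makes it a unit.\<close>
  have "c dvd H div p" if p: "p \<in> monic_polys d" for p
  proof -
    have "p dvd L"
      unfolding L_def lcm_degree_def by (rule dvd_Lcm) (use monic_polysD(2)[OF p] in simp)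
    then obtain s where "L = p * s"
      by (elim dvdE)
    then show ?thesis
      using c monic_polysD(3)[OF p] by (simp add: mult.assoc)
  qed
  then have "is_unit c"
    using prim by (auto simp: primary_def)
  then have "normalize H = normalize L"
    using c by (simp add: normalize_mult is_unit_normalize)
  moreover have "normalize L = L"
    by (simp add: L_def lcm_degree_def)
  ultimately show ?thesis
    using monic_polysD(4)[OF H(1)] by (simp add: L_def)
qed

text \<open>The map taking \<open>h\<close> to \<open>f div h\<close> embeds \<open>K\<close> into
  the monic polynomials of degree \<open>n - l\<close> other than \<open>P\<close>. Both sides have
  \<open>CARD('a) ^ (n - l) - 1\<close> elements, so every such polynomial occurs. With
  \<open>H = P * f\<close>, the member \<open>P * h\<close> is \<open>H div (f div h)\<close>, and
  \<open>P\<close> itself yields \<open>f\<close>.\<close>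

lemma quotient_family_of_single:
  fixes f P :: "'a::{finite,field_gcd} poly"
  assumes F: "F = {f} \<union> (*) P ` K" "{f} \<inter> (*) P ` K = {}" "card F = CARD('a) ^ (n - l)" "l < n"
    and f: "f \<in> monic_polys n" and K: "K \<subseteq> monic_polys l" "\<And>h. h \<in> K \<Longrightarrow> h dvd f"
    and P: "P \<in> monic_polys (n - l)" and prim: "primary F"
  shows "F = quotient_family (n - l)"
proof -
  let ?M = "monic_polys (n - l) :: 'a poly set"
  define H where "H = P * f"
  have H: "H \<in> monic_polys (n - l + n)"
    unfolding H_def by (rule monic_polys_mult[OF P f])
  have ne: "P \<noteq> 0" "f \<noteq> 0" "\<And>h. h \<in> K \<Longrightarrow> h \<noteq> 0"
    using P f K(1) monic_polysD(3) by auto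
  have fh: "f = h * (f div h)" if "h \<in> K" for h
    using K(2)[OF that] by simp
  have finK: "finite K"
    using K(1) by (rule finite_subset) simp
  have inj: "inj_on (\<lambda>h. f div h) K"
  proof (rule inj_onI)
    fix h h'
    assume *: "h \<in> K" "h' \<in> K" "f div h = f div h'"
    then have "h * (f div h) = h' * (f div h)"
      using fh by metis
    moreover have "f div h \<noteq> 0"
      using fh[OF *(1)] ne(2) by force
    ultimately show "h = h'"
      by simp
  qed
  have sub: "(\<lambda>h. f div h) ` K \<subseteq> ?M - {P}"
  proof (rule image_subsetI)
    fix h
    assume h: "h \<in> K"
    then have "h * (f div h) \<in> monic_polys n" "h \<in> monic_polys l"
      using f fh K(1) by auto
    then have "f div h \<in> ?M"
      by (rule monic_polys_cofactor)
    \<comment> \<open>Otherwise \<open>f = P * h\<close> would lie in both parts of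
      \<open>F\<close>.\<close>
    moreover have "f div h \<noteq> P"
    proof
      assume "f div h = P"
      then have "f = P * h"
        using fh[OF h] by (simp add: mult.commute)
      then show False
        using F(2) h by blast
    qed
    ultimately show "f div h \<in> ?M - {P}"
      by simp
  qed
  have "card F = Suc (card K)"
  proof -
    have "card ((*) P ` K) = card K"
      using ne(1) by (intro card_image) (simp add: inj_on_def)
    then show ?thesis
      using F(1,2) finK by simp
  qed
  moreover have "card (?M - {P}) = CARD('a) ^ (n - l) - 1"
    using P by (simp add: card_monic_polys)
  ultimately have "card ((\<lambda>h. f div h) ` K) = card (?M - {P})"
    using F(3) by (simp add: card_image[OF inj])
  then have img: "(\<lambda>h. f div h) ` K = ?M - {P}"
    by (intro card_subset_eq sub) simp
  have quot: "H div (f div h) = P * h" "(f div h) dvd H" if "h \<in> K" for h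
  proof -
    have "H = f div h * (P * h)" "f div h \<noteq> 0"
      using fh[OF that] ne(2) by (simp_all add: H_def ac_simps) force
    then show "H div (f div h) = P * h" "(f div h) dvd H"
      by (metis nonzero_mult_div_cancel_left, metis dvd_triv_left)
  qed
  have M: "?M = insert P ((\<lambda>h. f div h) ` K)"
    using img P by auto
  have "H div P = f"
    using ne(1) by (simp add: H_def)
  then have "(\<lambda>p. H div p) ` ?M = F"
    unfolding M F(1) by (simp add: image_image quot(1) cong: image_cong)
  then have FH: "F = {H div p |p. p \<in> ?M}"
    by auto
  have "p dvd H" if "p \<in> ?M" for p
    using that quot(2) unfolding M by (auto simp: H_def)
  then have "H = lcm_degree (n - l)"
    using H F(4) prim unfolding FH by (intro eq_lcm_degree) auto
  then show ?thesis
    using FH by (simp add: quotient_family_def)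
qed

text \<open>Each divisor is replaced by its complementary divisor. The map is stated along with the
  bound because the case of equality needs its image.\<close>

lemma card_monic_divisors_le:
  fixes G :: "'a::{finite,field_gcd} poly"
  assumes G: "G \<in> monic_polys k" and K: "K \<subseteq> monic_polys l" "\<And>h. h \<in> K \<Longrightarrow> h dvd G"
  shows "inj_on (\<lambda>h. G div h) K" "(\<lambda>h. G div h) ` K \<subseteq> monic_polys (k - l)"
    "card K \<le> CARD('a) ^ (k - l)"
proof -
  have eq: "G = h * (G div h)" if "h \<in> K" for h
    using K(2)[OF that] by simp
  show inj: "inj_on (\<lambda>h. G div h) K"
  proof (rule inj_onI)
    fix h h'
    assume *: "h \<in> K" "h' \<in> K" "G div h = G div h'"
    then have "h * (G div h) = h' * (G div h)"
      using eq by metis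
    moreover have "G div h \<noteq> 0"
      using eq[OF *(1)] monic_polysD(3)[OF G] by force
    ultimately show "h = h'"
      by simp
  qed
  show sub: "(\<lambda>h. G div h) ` K \<subseteq> monic_polys (k - l)"
  proof (rule image_subsetI)
    fix h
    assume h: "h \<in> K"
    then have "h * (G div h) \<in> monic_polys k" "h \<in> monic_polys l"
      using G eq K(1) by auto
    then show "G div h \<in> monic_polys (k - l)"
      by (rule monic_polys_cofactor)
  qed
  show "card K \<le> CARD('a) ^ (k - l)"
    using card_inj_on_le[OF inj sub] by (simp add: card_monic_polys)
qed

section \<open>The field with two elements and the exceptional family\<close>

lemma UNIV_card_2:
  assumes "CARD('a::{finite,field_gcd}) = 2"
  shows "UNIV = {0, 1 :: 'a}"
  using assms by (intro card_subset_eq[symmetric]) auto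

lemma one_plus_one_card_2:
  assumes "CARD('a::{finite,field_gcd}) = 2"
  shows "(1 :: 'a) + 1 = 0"
  using UNIV_card_2[OF assms] by (metis UNIV_I add_cancel_left_right insertE singletonD zero_neq_one)

lemma monic_polys_1_card_2:
  assumes "CARD('a::{finite,field_gcd}) = 2"
  shows "monic_polys 1 = {[:0, 1:], [:1, 1 :: 'a:]}"
proof -
  have "low_polys 1 = (\<lambda>a :: 'a. [:a:]) ` {0, 1}"
    unfolding One_nat_def low_polys_Suc low_polys_0 UNIV_card_2[OF assms] by auto
  then show ?thesis
    by (simp add: monic_polys_eq_image monom_Suc one_pCons)
qed

text \<open>An irreducible quadratic has no root; being nonzero at both \<open>0\<close> and
  \<open>1\<close> fixes the two lower coefficients.\<close>

lemma prime_poly_degree_2_card_2: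
  fixes P :: "'a::{finite,field_gcd} poly"
  assumes q: "CARD('a) = 2" and P: "prime P" "degree P = 2"
  shows "P = [:1, 1, 1:]"
proof -
  have "P \<in> monic_polys (Suc (Suc 0))"
    using prime_poly_monic(1)[OF P(1)] P(2) by (simp add: numeral_2_eq_2)
  then obtain c b where Pc: "P = [:c, b, 1:]"
    by (auto simp: monic_polys_eq_image low_polys_Suc low_polys_0 monom_Suc)
  have noroot: "poly P x \<noteq> 0" for x
  proof
    assume "poly P x = 0"
    then have "[:- x, 1:] dvd P"
      by (simp add: poly_eq_0_iff_dvd)
    then have "[:- x, 1:] dvd 1 \<or> P dvd [:- x, 1:]"
      using P(1) by (meson irreducibleD' prime_elem_imp_irreducible prime_imp_prime_elem)
    then show False
      using P(2) dvd_imp_degree_le[of P "[:- x, 1:]"] by (auto simp: is_unit_poly_iff)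
  qed
  have "c \<noteq> 0" "c + b + 1 \<noteq> 0"
    using noroot[of 0] noroot[of 1] by (auto simp: Pc add.assoc)
  moreover have "c \<in> {0, 1}" "b \<in> {0, 1}"
    using UNIV_card_2[OF q] by auto
  ultimately show ?thesis
    using one_plus_one_card_2[OF q] Pc by auto
qed

text \<open>Once \<open>q = 2\<close>, both bounds \<open>q ^ (m - 1)\<close> are equalities. Then
  \<open>F0\<close> contains all monic multiples of \<open>L\<close> of degree \<open>n\<close>,
  which forces every \<open>h\<close> in \<open>K\<close> to divide \<open>L\<close>. As
  \<open>degree L = l + 1\<close>, only two such divisors are possible, whence
  \<open>m = 2\<close>.\<close>

lemma exceptional_family:
  fixes F0 K :: "'a::{finite,field_gcd} poly set"
  assumes F: "F = F0 \<union> (*) P ` K" "F0 \<inter> (*) P ` K = {}" "card F = CARD('a) ^ (n - l)" "l < n"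
    and F0: "F0 \<subseteq> monic_polys n" "card F0 \<ge> 2"
    and K: "K \<subseteq> monic_polys l" "\<And>f h. f \<in> F0 \<Longrightarrow> h \<in> K \<Longrightarrow> h dvd f" "card K \<ge> 2"
    and P: "prime P" "degree P = n - l" and prim: "primary F"
  shows "CARD('a) = 2 \<and> l = 1 \<and> n = 3 \<and>
       F = {[:0, 1:]^2 * [:1, 1:], [:0, 1:] * [:1, 1:]^2,
            [:0, 1:] * [:1, 1, 1:], [:1, 1:] * [:1, 1, 1:]}"
proof -
  let ?q = "CARD('a)"
  define m where "m = n - l"
  have m: "m > 0" "n = l + m"
    using F(4) by (auto simp: m_def)
  have fin: "finite F0" "finite K"
    using F0(1) K(1) by (auto intro: finite_subset)
  have P0: "P \<noteq> 0"
    using P(1) by auto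
  have "card ((*) P ` K) = card K"
    using P0 by (intro card_image) (simp add: inj_on_def)
  then have total: "card F0 + card K = ?q ^ m"
    using F(1-3) fin card_Un_disjoint[of F0 "(*) P ` K"] by (simp add: m_def)
  obtain h0 h1 where h: "h0 \<in> K" "h1 \<in> K" "h0 \<noteq> h1"
    using K(3) by (metis One_nat_def card_le_Suc0_iff_eq fin(2) not_less_eq_eq numeral_2_eq_2)
  obtain f0 f1 where f: "f0 \<in> F0" "f1 \<in> F0" "f0 \<noteq> f1"
    using F0(2) by (metis One_nat_def card_le_Suc0_iff_eq fin(1) not_less_eq_eq numeral_2_eq_2)
  define L where "L = lcm h0 h1"
  have h': "h0 \<in> monic_polys l" "h1 \<in> monic_polys l"
    using h K(1) by auto
  have L0: "L \<noteq> 0" "normalize L = L" "h0 dvd L" "h1 dvd L"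
    using monic_polysD(3)[OF h'(1)] monic_polysD(3)[OF h'(2)] by (auto simp: L_def lcm_eq_0_iff)
  then have L: "L \<in> monic_polys (degree L)"
    by (intro monic_polysI) auto
  \<comment> \<open>In degree \<open>l\<close>, both \<open>h0\<close> and \<open>h1\<close> would
    coincide with their lcm.\<close>
  have Lgt: "degree L > l"
  proof (rule ccontr)
    assume "\<not> l < degree L"
    moreover have "l \<le> degree L"
      using dvd_imp_degree_le[OF L0(3,1)] monic_polysD(2)[OF h'(1)] by simp
    ultimately have "L \<in> monic_polys l"
      using L by simp
    then show False
      using monic_dvd_imp_eq[OF h'(1) _ L0(3)] monic_dvd_imp_eq[OF h'(2) _ L0(4)] h(3) by simp
  qed
  have F0L: "F0 \<subseteq> {f \<in> monic_polys n. L dvd f}"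
    using F0(1) K(2) h by (auto simp: L_def)
  have LF0: "card F0 \<le> card {f \<in> (monic_polys n :: 'a poly set). L dvd f}"
    by (intro card_mono F0L) simp
  have Ln: "degree L \<le> n"
  proof (rule ccontr)
    assume "\<not> degree L \<le> n"
    then show False
      using LF0 F0(2) by (simp add: card_monic_multiples[OF L])
  qed
  then have cF0: "card F0 \<le> ?q ^ (n - degree L)"
    using LF0 by (simp add: card_monic_multiples[OF L])
  define G where "G = gcd f0 f1"
  have f': "f0 \<in> monic_polys n" "f1 \<in> monic_polys n"
    using f F0(1) by auto
  have G: "G \<in> monic_polys (degree G)"
    unfolding G_def by (rule gcd_monic_polys[OF f'(1)])
  have Gn: "degree G < n"
  proof (rule ccontr)
    assume "\<not> degree G < n"
    moreover have "degree G \<le> n"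
      using dvd_imp_degree_le[of G f0] monic_polysD(2,3)[OF f'(1)] by (simp add: G_def)
    ultimately have "G \<in> monic_polys n"
      using G by simp
    then show False
      using monic_dvd_imp_eq[OF _ f'(1), of G] monic_dvd_imp_eq[OF _ f'(2), of G] f(3)
      by (metis G_def gcd_dvd1 gcd_dvd2)
  qed
  have "card K \<le> ?q ^ (degree G - l)"
    using card_monic_divisors_le(3)[OF G K(1)] K(2) f by (auto simp: G_def)
  also have "\<dots> \<le> ?q ^ (m - 1)"
    using Gn m by (intro power_increasing) auto
  finally have cK: "card K \<le> ?q ^ (m - 1)" .
  have cF0': "card F0 \<le> ?q ^ (m - 1)"
  proof -
    have "?q ^ (n - degree L) \<le> ?q ^ (m - 1)"
      using Lgt m(2) by (intro power_increasing) auto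
    then show ?thesis
      using cF0 by linarith
  qed
  have qm: "?q ^ m = ?q * ?q ^ (m - 1)"
    using m(1) by (cases m) auto
  have "?q * ?q ^ (m - 1) \<le> 2 * ?q ^ (m - 1)"
    using total cK cF0' qm by linarith
  then have q: "?q = 2"
    using card_UNIV_field_ge_2[where 'a='a] by simp
  have cards: "card F0 = 2 ^ (m - 1)" "card K = 2 ^ (m - 1)"
    using total cK cF0' qm q by simp_all
  have "m - 1 > 0"
    using cards F0(2) by (cases "m - 1") auto
  \<comment> \<open>\<open>2 ^ (m - 1) = card F0 \<le> 2 ^ (n - degree L)\<close> bounds
    \<open>degree L\<close> by \<open>l + 1\<close>.\<close>
  have "m - 1 \<le> n - degree L"
    using cF0 cards q by (simp add: power_increasing_iff)
  then have degL: "degree L = Suc l"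
    using Lgt m Ln by linarith
  have F0_eq: "F0 = (*) L ` monic_polys (m - 1)"
  proof -
    have "F0 = {f \<in> monic_polys n. L dvd f}"
      using F0L Ln degL m q cards by (intro card_subset_eq) (auto simp: card_monic_multiples[OF L])
    then show ?thesis
      using monic_multiples[OF L, of n] Ln degL m by simp
  qed
  define x y :: "'a poly" where xy_def: "x = [:0, 1:]" "y = [:1, 1:]"
  have M1: "monic_polys 1 = {x, y}" and xy: "x \<in> monic_polys 1" "y \<in> monic_polys 1" "x \<noteq> y"
    using monic_polys_1_card_2[OF q] by (auto simp: xy_def)
  have xy0: "x \<noteq> 0" "y \<noteq> 0"
    by (simp_all add: xy_def)
  have cop: "coprime x y"
  proof (rule coprimeI)
    fix c
    assume "c dvd x" "c dvd y"
    then have "c dvd y - x"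
      by (rule dvd_diff[rotated])
    then show "is_unit c"
      by (simp add: xy_def one_pCons)
  qed
  have hL: "h dvd L" if "h \<in> K" for h
  proof -
    \<comment> \<open>Two members of \<open>F0\<close> with coprime cofactors suffice: their gcd is
      \<open>L\<close>.\<close>
    have "L * x ^ (m - 1) \<in> F0" "L * y ^ (m - 1) \<in> F0"
      using monic_polys_power[OF xy(1), of "m - 1"] monic_polys_power[OF xy(2), of "m - 1"]
      unfolding F0_eq by (auto intro!: imageI)
    then have "h dvd gcd (L * x ^ (m - 1)) (L * y ^ (m - 1))"
      using K(2) that by simp
    also have "gcd (L * x ^ (m - 1)) (L * y ^ (m - 1)) = L"
      using cop L0(2) by (simp add: gcd_mult_left coprime_power_left_iff coprime_power_right_iff coprime_imp_gcd_eq_1)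
    finally show ?thesis .
  qed
  note KL = card_monic_divisors_le[OF L K(1) hL]
  \<comment> \<open>Elements of \<open>K\<close> have linear cofactors in \<open>L\<close>, and only
    two monic linear polynomials exist.\<close>
  have "2 ^ (m - 1) \<le> (2 :: nat) ^ 1"
    using KL(3) cards q degL by simp
  then have m2: "m = 2"
    using \<open>m - 1 > 0\<close> by (subst (asm) power_increasing_iff) auto
  \<comment> \<open>\<open>K\<close> now has exactly two elements, so both \<open>x\<close> and
    \<open>y\<close> occur as cofactors.\<close>
  have img: "(\<lambda>h. L div h) ` K = {x, y}"
    using KL(2) cards m2 degL xy(3) M1
    by (intro card_subset_eq) (simp_all add: card_image[OF KL(1)])
  then obtain hx hy where hxy: "hx \<in> K" "L div hx = x" "hy \<in> K" "L div hy = y"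
    by (metis imageE insertI1 insertI2)
  have Leq: "L = hx * x" "L = hy * y"
    using hL hxy by (metis dvd_mult_div_cancel)+
  then have "x * y dvd L"
    by (metis cop divides_mult dvd_triv_right)
  then obtain C where C: "L = x * y * C"
    by (elim dvdE)
  have hx: "hx = y * C" and hy: "hy = x * C"
    using Leq C xy0 mult_left_cancel[of x hx "y * C"] mult_left_cancel[of y hy "x * C"]
    by (simp_all add: ac_simps)
  have K_eq: "K = {hx, hy}"
  proof (rule card_subset_eq[symmetric])
    show "finite K" "{hx, hy} \<subseteq> K"
      using fin hxy by auto
    have "hx \<noteq> hy"
      using hxy xy(3) by auto
    then show "card {hx, hy} = card K"
      using cards m2 by simp
  qed
  have F0_eq': "F0 = {L * x, L * y}"
    unfolding F0_eq using M1 m2 by simp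
  \<comment> \<open>All four members carry the factor \<open>C\<close>, so primarity leaves only
    \<open>C = 1\<close>.\<close>
  have F_eq: "F = {L * x, L * y, P * (y * C), P * (x * C)}"
    unfolding F(1) F0_eq' K_eq hx hy by auto
  then have "\<forall>p\<in>F. C dvd p"
    by (auto simp: C)
  then have "is_unit C"
    using prim by (auto simp: primary_def)
  moreover have "C \<in> monic_polys (degree L - (1 + 1))"
    using monic_polys_cofactor(1)[OF _ monic_polys_mult[OF xy(1,2)], of C "degree L"] L C by simp
  ultimately have "C = 1"
    using monic_polysD(4) is_unit_normalize by metis
  then have Lxy: "L = x * y"
    using C by simp
  then have "degree L = 2"
    by (simp add: xy_def)
  then have ln: "l = 1" "n = 3"
    using degL m m2 by auto
  have "P = [:1, 1, 1:]"
    using P m2 by (intro prime_poly_degree_2_card_2 q) (simp_all add: m_def)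
  then have "F = {[:0, 1:]^2 * [:1, 1:], [:0, 1:] * [:1, 1:]^2,
            [:0, 1:] * [:1, 1, 1:], [:1, 1:] * [:1, 1, 1:]}"
    unfolding F_eq Lxy \<open>C = 1\<close> xy_def power2_eq_square mult_1_right by (auto simp only: ac_simps)
  then show ?thesis
    using q ln by blast
qed

section \<open>Combining the cases according to the sizes of the two parts\<close>

theorem theorem3:
  fixes F :: "'a::{finite,field_gcd} poly set" and n l :: nat
  assumes "l \<le> n"
    and "max_intersecting n l F"
    and "primary F"
    and "\<not> trivial_family n l F"
  shows "card F = CARD('a) ^ (n - l) \<and>
    ((CARD('a) = 2 \<and> l = 1 \<and> n = 3 \<and>
       F = {[:0, 1:]^2 * [:1, 1:], [:0, 1:] * [:1, 1:]^2,
            [:0, 1:] * [:1, 1, 1:], [:1, 1:] * [:1, 1, 1:]})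
     \<or> (\<exists>d>0. F = quotient_family d))"
proof
  show card: "card F = CARD('a) ^ (n - l)"
    using assms(1,2) by (rule card_max_intersecting[rotated])
  have F: "F \<subseteq> monic_polys n" "intersecting l F"
    using assms(2) by (auto simp: max_intersecting_def)
  \<comment> \<open>For \<open>l = n\<close> the family is a singleton, hence trivial. Excluding
    this gives the prime \<open>P\<close> a positive degree.\<close>
  have "l \<noteq> n"
  proof
    assume "l = n"
    then obtain f where "F = {f}"
      using card by (auto simp: card_1_singleton_iff)
    then show False
      using trivial_familyI[OF F(1) assms(1) card, of f] F(1) \<open>l = n\<close> assms(4) by simp
  qed
  then have ln: "l < n"
    using assms(1) by simp
  obtain P :: "'a poly" where P: "prime P" "degree P = n - l"
    using exists_prime_poly_degree[of "n - l"] ln by auto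
  obtain F0 K where split: "F = F0 \<union> (*) P ` K" "F0 \<inter> (*) P ` K = {}" "F0 \<noteq> {}" "K \<noteq> {}"
    "K \<subseteq> monic_polys l" "\<And>f h. f \<in> F0 \<Longrightarrow> h \<in> K \<Longrightarrow> h dvd f"
    using split_by_multiplicity[OF F assms(1) card P] by blast
  have F0: "F0 \<subseteq> monic_polys n"
    using split(1) F(1) by blast
  have fin: "finite F0" "finite K"
    using F0 split(5) by (auto intro: finite_subset)
  have "card K \<noteq> 1"
  proof
    assume "card K = 1"
    then obtain h where h: "K = {h}"
      by (rule card_1_singletonE)
    have "h dvd f" if "f \<in> F" for f
      using that split(1,6) h by auto
    then show False
      using trivial_familyI[OF F(1) assms(1) card, of h] split(5) h assms(4) by auto
  qed
  moreover have "card K \<noteq> 0"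
    using fin split(4) by simp
  ultimately have K2: "card K \<ge> 2"
    by linarith
  show "(CARD('a) = 2 \<and> l = 1 \<and> n = 3 \<and>
       F = {[:0, 1:]^2 * [:1, 1:], [:0, 1:] * [:1, 1:]^2,
            [:0, 1:] * [:1, 1, 1:], [:1, 1:] * [:1, 1, 1:]})
     \<or> (\<exists>d>0. F = quotient_family d)"
  proof (cases "card F0 = 1")
    case True
    then obtain f where f: "F0 = {f}"
      by (rule card_1_singletonE)
    have "F = quotient_family (n - l)"
    proof (rule quotient_family_of_single)
      show "P \<in> monic_polys (n - l)"
        using prime_poly_monic(1)[OF P(1)] P(2) by simp
      show "f \<in> monic_polys n" "\<And>h. h \<in> K \<Longrightarrow> h dvd f"
        using F0 f split(6) by auto
      show "F = {f} \<union> (*) P ` K" "{f} \<inter> (*) P ` K = {}"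
        using split(1,2) f by simp_all
    qed (fact card ln split(5) assms(3))+
    moreover have "n - l > 0"
      using ln by simp
    ultimately show ?thesis
      by blast
  next
    case False
    moreover have "card F0 \<noteq> 0"
      using fin split(3) by simp
    ultimately have "card F0 \<ge> 2"
      by linarith
    then show ?thesis
      using exceptional_family[OF split(1,2) card ln F0 _ split(5,6) K2 P assms(3)] by blast
  qed
qed

end
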